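(* Let $\mathcal{K}=(Q,\delta,\lambda)$ be a Kripke structure and $(S^+,S^-)$ a sample of $\mathcal{K}$. Then the separating formula $\mathcal{S}_\mathcal{K}(S^+,S^-)=\bigvee_{q^+\in S^+}\bigwedge_{q^-\in S^-}D_{q^+,q^-}$ is well defined and consistent with $(S^+,S^-)$, i.e. $q^+\models_\mathcal{K}\mathcal{S}_\mathcal{K}(S^+,S^-)$ for all $q^+\in S^+$ and $q^-\not\models_\mathcal{K}\mathcal{S}_\mathcal{K}(S^+,S^-)$ for all $q^-\in S^-$.
   Context: A Kripke structure is $\mathcal{K}=(Q,\delta,\lambda)$ with $Q$ finite, $\delta:Q\to2^Q\setminus\{\emptyset\}$, $\lambda:Q\to2^{\mathsf{AP}}$ for a finite set $\mathsf{AP}$; both $\mathsf{AP}$ and $Q$ are assumed totally ordered. Define equivalences $\sim_i$ on $Q$: $q_1\sim_0q_2$ iff $\lambda(q_1)=\lambda(q_2)$; $q_1\sim_{i+1}q_2$ iff $q_1\sim_iq_2$ and $\{[q_1']_{\sim_i}\mid q_1'\in\delta(q_1)\}=\{[q_2']_{\sim_i}\mid q_2'\in\delta(q_2)\}$. The bisimulation $\sim$ is the coarsest equivalence such that $q_1\sim q_2$ implies $\lambda(q_1)=\lambda(q_2)$ and every successor of $q_1$ is $\sim$-related to some successor of $q_2$; it equals $\sim_i$ for all large enough $i$. A sample is a pair $(S^+,S^-)$ of subsets of $Q$ with $q^+\not\sim q^-$ for all $q^+\in S^+,q^-\in S^-$. For sets $A,B\subseteq Q$ with no element of $A$ bisimilar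 to an element of $B$, $\mathcal{C}_\mathcal{K}(A,B)$ is the smallest $c\in\mathbb{N}$ with $a\not\sim_c b$ for all $a\in A,b\in B$. For $q_1\not\sim q_2$, with $c=\mathcal{C}_\mathcal{K}(\{q_1\},\{q_2\})$, the formula $D_{q_1,q_2}$ is defined inductively on $c$: if $c=0$ and $\lambda(q_1)\setminus\lambda(q_2)\neq\emptyset$ with minimal element $a$, $D_{q_1,q_2}=a$; else if $c=0$ and $\lambda(q_2)\setminus\lambda(q_1)\ne\emptyset$ with minimal element $a$, $D_{q_1,q_2}=\neg a$; else if $c\neq0$ and there is $q_1'\in\delta(q_1)$ with $q_1'\not\sim_{c-1}q_2'$ for all $q_2'\in\delta(q_2)$, then, taking the smallest such $q_1'$, $D_{q_1,q_2}=\exists\mathsf{X}\bigl(\bigwedge_{q_2'\in\delta(q_2)}D_{q_1',q_2'}\bigr)$; else if $c\ne0$ and there is $q_2'\in\delta(q_2)$ with $q_1'\not\sim_{c-1}q_2'$ for all $q_1'\in\delta(q_1)$, then, taking the smallest such $q_2'$, $D_{q_1,q_2}=\forall\mathsf{X}\,\neg\bigl(\bigwedge_{q_1'\in\delta(q_1)}D_{q_2',q_1'}\bigr)$. Here $\exists\mathsf{X}\varphi$ holds at $q$ iff some successor satisfies $\varphi$, and $\forall\mathsf{X}\varphi$ iff all successors satisfy $\varphi$. A formula $\varphi$ is consistent with $(S^+,S^-)$ if it holds at every state of $S^+$ and at no state of $S^-$. *)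

theory Defs
  imports Main
begin

record ('q, 'ap) kripke =
  states :: "'q set"
  props :: "'ap set"
  succs :: "'q \<Rightarrow> 'q set"
  label :: "'q \<Rightarrow> 'ap set"

definition kripke_structure :: "('q, 'ap) kripke \<Rightarrow> bool" where
  "kripke_structure K \<longleftrightarrow>
     finite (states K) \<and> finite (props K) \<and>
     (\<forall>q\<in>states K. succs K q \<subseteq> states K \<and> succs K q \<noteq> {} \<and> label K q \<subseteq> props K)"

(* For a set A of states, A // r is the set of r-classes of the elements of A. *)
primrec bisim_upto :: "('q, 'ap) kripke \<Rightarrow> nat \<Rightarrow> ('q \<times> 'q) set" where
  "bisim_upto K 0 =
     {(q1, q2). q1 \<in> states K \<and> q2 \<in> states K \<and> label K q1 = label K q2}"
| "bisim_upto K (Suc i) =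
     {(q1, q2). (q1, q2) \<in> bisim_upto K i \<and>
                succs K q1 // bisim_upto K i = succs K q2 // bisim_upto K i}"

definition bisim_equiv :: "('q, 'ap) kripke \<Rightarrow> ('q \<times> 'q) set \<Rightarrow> bool" where
  "bisim_equiv K R \<longleftrightarrow>
     equiv (states K) R \<and>
     (\<forall>(q1, q2)\<in>R. label K q1 = label K q2 \<and>
        (\<forall>q1'\<in>succs K q1. \<exists>q2'\<in>succs K q2. (q1', q2') \<in> R))"

(* Coarsest means greatest with respect to inclusion. *)
definition bisim :: "('q, 'ap) kripke \<Rightarrow> ('q \<times> 'q) set" where
  "bisim K = (GREATEST R. bisim_equiv K R)"

definition sample :: "('q, 'ap) kripke \<Rightarrow> 'q set \<Rightarrow> 'q set \<Rightarrow> bool" where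
  "sample K Sp Sm \<longleftrightarrow>
     Sp \<subseteq> states K \<and> Sm \<subseteq> states K \<and> (\<forall>p\<in>Sp. \<forall>m\<in>Sm. (p, m) \<notin> bisim K)"

definition char_number :: "('q, 'ap) kripke \<Rightarrow> 'q set \<Rightarrow> 'q set \<Rightarrow> nat" where
  "char_number K A B = (LEAST c. \<forall>a\<in>A. \<forall>b\<in>B. (a, b) \<notin> bisim_upto K c)"

datatype 'ap formula =
    Top
  | Atom 'ap
  | Neg "'ap formula"
  | And "'ap formula" "'ap formula"
  | Or "'ap formula" "'ap formula"
  | ExNext "'ap formula"
  | AllNext "'ap formula"

primrec sat :: "('q, 'ap) kripke \<Rightarrow> 'q \<Rightarrow> 'ap formula \<Rightarrow> bool" where
  "sat K q Top \<longleftrightarrow> True"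
| "sat K q (Atom a) \<longleftrightarrow> a \<in> label K q"
| "sat K q (Neg \<phi>) \<longleftrightarrow> \<not> sat K q \<phi>"
| "sat K q (And \<phi> \<psi>) \<longleftrightarrow> sat K q \<phi> \<and> sat K q \<psi>"
| "sat K q (Or \<phi> \<psi>) \<longleftrightarrow> sat K q \<phi> \<or> sat K q \<psi>"
| "sat K q (ExNext \<phi>) \<longleftrightarrow> (\<exists>q'\<in>succs K q. sat K q' \<phi>)"
| "sat K q (AllNext \<phi>) \<longleftrightarrow> (\<forall>q'\<in>succs K q. sat K q' \<phi>)"

definition consistent ::
  "('q, 'ap) kripke \<Rightarrow> 'ap formula \<Rightarrow> 'q set \<Rightarrow> 'q set \<Rightarrow> bool" where
  "consistent K \<phi> Sp Sm \<longleftrightarrow> (\<forall>q\<in>Sp. sat K q \<phi>) \<and> (\<forall>q\<in>Sm. \<not> sat K q \<phi>)"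

fun conj_list :: "'ap formula list \<Rightarrow> 'ap formula" where
  "conj_list [] = Top"
| "conj_list [\<phi>] = \<phi>"
| "conj_list (\<phi> # \<psi> # \<psi>s) = And \<phi> (conj_list (\<psi> # \<psi>s))"

fun disj_list :: "'ap formula list \<Rightarrow> 'ap formula" where
  "disj_list [] = Neg Top"
| "disj_list [\<phi>] = \<phi>"
| "disj_list (\<phi> # \<psi> # \<psi>s) = Or \<phi> (disj_list (\<psi> # \<psi>s))"

(* Finite connectives indexed by a set of states, in the order of the states. *)
definition big_conj :: "'q::linorder set \<Rightarrow> ('q \<Rightarrow> 'ap formula) \<Rightarrow> 'ap formula" where
  "big_conj A f = conj_list (map f (sorted_list_of_set A))"

definition big_disj :: "'q::linorder set \<Rightarrow> ('q \<Rightarrow> 'ap formula) \<Rightarrow> 'ap formula" where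
  "big_disj A f = disj_list (map f (sorted_list_of_set A))"

(* The defining clauses of D are given as a relation between pairs of states and formulas,
   so that D being well defined at (q1, q2) is the nontrivial assertion that exactly one
   formula is related to (q1, q2). *)
inductive is_D ::
  "('q::linorder, 'ap::linorder) kripke \<Rightarrow> 'q \<Rightarrow> 'q \<Rightarrow> 'ap formula \<Rightarrow> bool"
  for K where
  atom: "\<lbrakk>q1 \<in> states K; q2 \<in> states K; (q1, q2) \<notin> bisim K;
      char_number K {q1} {q2} = 0;
      label K q1 - label K q2 \<noteq> {}\<rbrakk>
    \<Longrightarrow> is_D K q1 q2 (Atom (Min (label K q1 - label K q2)))"
| neg_atom: "\<lbrakk>q1 \<in> states K; q2 \<in> states K; (q1, q2) \<notin> bisim K;
      char_number K {q1} {q2} = 0;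
      label K q1 - label K q2 = {};
      label K q2 - label K q1 \<noteq> {}\<rbrakk>
    \<Longrightarrow> is_D K q1 q2 (Neg (Atom (Min (label K q2 - label K q1))))"
| ex_next: "\<lbrakk>q1 \<in> states K; q2 \<in> states K; (q1, q2) \<notin> bisim K;
      char_number K {q1} {q2} = c; c \<noteq> 0;
      E = {q1' \<in> succs K q1. \<forall>q2'\<in>succs K q2. (q1', q2') \<notin> bisim_upto K (c - 1)};
      E \<noteq> {};
      \<forall>q2'\<in>succs K q2. is_D K (Min E) q2' (\<psi> q2')\<rbrakk>
    \<Longrightarrow> is_D K q1 q2 (ExNext (big_conj (succs K q2) \<psi>))"
| all_next: "\<lbrakk>q1 \<in> states K; q2 \<in> states K; (q1, q2) \<notin> bisim K;
      char_number K {q1} {q2} = c; c \<noteq> 0;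
      {q1' \<in> succs K q1. \<forall>q2'\<in>succs K q2. (q1', q2') \<notin> bisim_upto K (c - 1)} = {};
      F = {q2' \<in> succs K q2. \<forall>q1'\<in>succs K q1. (q1', q2') \<notin> bisim_upto K (c - 1)};
      F \<noteq> {};
      \<forall>q1'\<in>succs K q1. is_D K (Min F) q1' (\<psi> q1')\<rbrakk>
    \<Longrightarrow> is_D K q1 q2 (AllNext (Neg (big_conj (succs K q1) \<psi>)))"

definition D ::
  "('q::linorder, 'ap::linorder) kripke \<Rightarrow> 'q \<Rightarrow> 'q \<Rightarrow> 'ap formula" where
  "D K q1 q2 = (THE \<phi>. is_D K q1 q2 \<phi>)"

definition separating_formula ::
  "('q::linorder, 'ap::linorder) kripke \<Rightarrow> 'q set \<Rightarrow> 'q set \<Rightarrow> 'ap formula" where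
  "separating_formula K Sp Sm = big_disj Sp (\<lambda>p. big_conj Sm (\<lambda>m. D K p m))"

end

theory Submission imports Defs begin

text \<open>
  Since successor sets are finite, the bisimulation is the intersection of the relations
  \<open>\<sim>\<^sub>i\<close>; hence non-bisimilar states have a well-defined characteristic number \<open>c\<close>, and if
  \<open>c > 0\<close> the failure of \<open>\<sim>\<^sub>c\<close> yields a successor of one of the two states that is not
  \<open>\<sim>\<^sub>c\<^sub>-\<^sub>1\<close>-related to any successor of the other. This makes the recursion for \<open>D\<close> total and
  well-founded, and its correctness follows by induction along the same recursion.
\<close>

section \<open>Semantics of finite connectives\<close>

lemma sat_conj_list: "sat K q (conj_list \<phi>s) \<longleftrightarrow> (\<forall>\<phi>\<in>set \<phi>s. sat K q \<phi>)"
  by (induction \<phi>s rule: conj_list.induct) auto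

lemma sat_disj_list: "sat K q (disj_list \<phi>s) \<longleftrightarrow> (\<exists>\<phi>\<in>set \<phi>s. sat K q \<phi>)"
  by (induction \<phi>s rule: disj_list.induct) auto

lemma sat_big_conj: "finite A \<Longrightarrow> sat K q (big_conj A f) \<longleftrightarrow> (\<forall>a\<in>A. sat K q (f a))"
  by (simp add: big_conj_def sat_conj_list)

lemma sat_big_disj: "finite A \<Longrightarrow> sat K q (big_disj A f) \<longleftrightarrow> (\<exists>a\<in>A. sat K q (f a))"
  by (simp add: big_disj_def sat_disj_list)

text \<open>A rule of \<open>is_D\<close> constrains \<open>\<psi>\<close> only on a successor set,
  so two admissible choices may differ elsewhere; the conjunction does not see the
  difference.\<close>

lemma big_conj_cong:
  assumes "finite A" "\<And>a. a \<in> A \<Longrightarrow> f a = g a"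
  shows "big_conj A f = big_conj A g"
  unfolding big_conj_def using assms by (metis map_cong set_sorted_list_of_set)

section \<open>The relations \<open>bisim_upto\<close>\<close>

lemma quotient_eq_iff:
  assumes "equiv A r" "B \<subseteq> A" "C \<subseteq> A"
  shows "B // r = C // r \<longleftrightarrow>
    (\<forall>b\<in>B. \<exists>c\<in>C. (b, c) \<in> r) \<and> (\<forall>c\<in>C. \<exists>b\<in>B. (b, c) \<in> r)"
proof -
  have eq: "r `` {x} = r `` {y} \<longleftrightarrow> (x, y) \<in> r" if "x \<in> A" "y \<in> A" for x y
    using eq_equiv_class_iff[OF assms(1) that] .
  have sub: "X // r \<subseteq> Y // r \<longleftrightarrow> (\<forall>x\<in>X. \<exists>y\<in>Y. (x, y) \<in> r)"
    if "X \<subseteq> A" "Y \<subseteq> A" for X Y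
  proof -
    have "X // r \<subseteq> Y // r \<longleftrightarrow> (\<forall>x\<in>X. \<exists>y\<in>Y. r `` {x} = r `` {y})"
      unfolding quotient_def by blast
    also have "\<dots> \<longleftrightarrow> (\<forall>x\<in>X. \<exists>y\<in>Y. (x, y) \<in> r)"
      using eq that by (meson subsetD)
    finally show ?thesis .
  qed
  have "(x, y) \<in> r \<longleftrightarrow> (y, x) \<in> r" for x y
    using assms(1) by (auto elim: equivE dest: symD)
  then show ?thesis
    unfolding set_eq_subset sub[OF assms(2,3)] sub[OF assms(3,2)] by metis
qed

lemma equiv_bisim_upto: "equiv (states K) (bisim_upto K i)"
proof (induction i)
  case 0
  show ?case by (simp add: equiv_def refl_on_def sym_on_def trans_on_def) blast
next
  case (Suc i)
  let ?r = "bisim_upto K i"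
  have r: "?r \<subseteq> states K \<times> states K" "refl_on (states K) ?r" "sym ?r" "trans ?r"
    using Suc by (simp_all add: equiv_def)
  show ?case
  proof (rule equivI)
    show "bisim_upto K (Suc i) \<subseteq> states K \<times> states K" using r(1) by auto
    show "refl_on (states K) (bisim_upto K (Suc i))"
      using r(2) by (simp add: refl_on_def)
    show "sym (bisim_upto K (Suc i))" using r(3) by (simp add: sym_on_def)
    show "trans (bisim_upto K (Suc i))" using transD[OF r(4)] by (auto intro: transI)
  qed
qed

lemma bisim_upto_antimono: "i \<le> j \<Longrightarrow> bisim_upto K j \<subseteq> bisim_upto K i"
  by (induction rule: dec_induct) auto

text \<open>The failure of a back-and-forth condition names a successor without a match, whereas
  inequality of class sets does not; \<open>D\<close> recurses on such a successor.\<close>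

lemma bisim_upto_Suc_iff:
  assumes "kripke_structure K" "q1 \<in> states K" "q2 \<in> states K"
  shows "(q1, q2) \<in> bisim_upto K (Suc i) \<longleftrightarrow> (q1, q2) \<in> bisim_upto K i \<and>
    (\<forall>q1'\<in>succs K q1. \<exists>q2'\<in>succs K q2. (q1', q2') \<in> bisim_upto K i) \<and>
    (\<forall>q2'\<in>succs K q2. \<exists>q1'\<in>succs K q1. (q1', q2') \<in> bisim_upto K i)"
  using assms quotient_eq_iff[OF equiv_bisim_upto[of K i], of "succs K q1" "succs K q2"]
  by (simp add: kripke_structure_def)

lemma finite_succs:
  "kripke_structure K \<Longrightarrow> q \<in> states K \<Longrightarrow> finite (succs K q)"
  unfolding kripke_structure_def by (meson finite_subset)

lemma finite_label:
  "kripke_structure K \<Longrightarrow> q \<in> states K \<Longrightarrow> finite (label K q)"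
  unfolding kripke_structure_def by (meson finite_subset)

section \<open>Bisimilarity as the limit of these relations\<close>

lemma bisim_equiv_subset_bisim_upto:
  assumes K: "kripke_structure K" and R: "bisim_equiv K R"
  shows "R \<subseteq> bisim_upto K i"
proof (induction i)
  case 0
  show ?case using R by (auto simp: bisim_equiv_def equiv_def refl_on_def)
next
  case (Suc i)
  have "sym R" and RK: "R \<subseteq> states K \<times> states K"
    using R by (auto simp: bisim_equiv_def elim!: equivE)
  have step: "\<forall>q1'\<in>succs K q1. \<exists>q2'\<in>succs K q2. (q1', q2') \<in> R"
    if "(q1, q2) \<in> R" for q1 q2
    using R that by (auto simp: bisim_equiv_def)
  show ?case
  proof
    fix p assume "p \<in> R"
    then obtain q1 q2 where p: "p = (q1, q2)" "(q1, q2) \<in> R" "(q2, q1) \<in> R"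
      using \<open>sym R\<close> by (metis surj_pair symD)
    have "q1 \<in> states K" "q2 \<in> states K" using RK p(2) by auto
    moreover have "\<forall>q1'\<in>succs K q1. \<exists>q2'\<in>succs K q2. (q1', q2') \<in> bisim_upto K i"
      using step[OF p(2)] Suc by blast
    \<comment> \<open>\<open>bisim_equiv\<close> demands only the forth condition; the back
      condition is forth for \<open>(q2, q1)\<close>, turned round by symmetry of
      \<open>R\<close>.\<close>
    moreover have "\<forall>q2'\<in>succs K q2. \<exists>q1'\<in>succs K q1. (q1', q2') \<in> bisim_upto K i"
      using step[OF p(3)] \<open>sym R\<close> Suc by (meson subsetD symD)
    ultimately show "p \<in> bisim_upto K (Suc i)"
      using bisim_upto_Suc_iff[OF K] p Suc by blast
  qed
qed

text \<open>Finite branching is the point: if each successor of \<open>q2\<close> failed as a match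
  at some level, one finite level would defeat them all.\<close>

lemma bisim_equiv_INT_bisim_upto:
  assumes K: "kripke_structure K"
  shows "bisim_equiv K (\<Inter>i. bisim_upto K i)"
proof -
  let ?R = "\<Inter>i. bisim_upto K i"
  have "equiv (states K) ?R"
  proof (rule equivI)
    have r: "bisim_upto K i \<subseteq> states K \<times> states K" "refl_on (states K) (bisim_upto K i)"
      "sym (bisim_upto K i)" "trans (bisim_upto K i)" for i
      using equiv_bisim_upto[of K i] by (simp_all add: equiv_def)
    show "?R \<subseteq> states K \<times> states K" using r(1) by blast
    show "refl_on (states K) ?R" using r(2) by (simp add: refl_on_def)
    show "sym ?R" using r(3) by (simp add: sym_INTER)
    show "trans ?R" using r(4) by (simp add: trans_INTER)
  qed
  moreover have "label K q1 = label K q2" if "(q1, q2) \<in> ?R" for q1 q2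
    using INT_D[OF that UNIV_I[of 0]] by simp
  moreover have "\<exists>q2'\<in>succs K q2. (q1', q2') \<in> ?R"
    if q: "(q1, q2) \<in> ?R" and q1': "q1' \<in> succs K q1" for q1 q2 q1'
  proof (rule ccontr)
    assume "\<not> ?thesis"
    then have "\<forall>q2'\<in>succs K q2. \<exists>i. (q1', q2') \<notin> bisim_upto K i" by auto
    then obtain f where f: "\<And>q2'. q2' \<in> succs K q2 \<Longrightarrow> (q1', q2') \<notin> bisim_upto K (f q2')"
      by metis
    have st: "q1 \<in> states K" "q2 \<in> states K"
      using INT_D[OF q UNIV_I[of 0]] by auto
    \<comment> \<open>\<open>n\<close> bounds the levels at which the candidates fail. Level
      \<open>Suc n\<close> for \<open>(q1, q2)\<close> yields a candidate matching at level
      \<open>n\<close>, hence by antimonotonicity also at its own failure level.\<close>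
    define n where "n = Max (f ` succs K q2)"
    have "(q1, q2) \<in> bisim_upto K (Suc n)" using q by blast
    then obtain q2' where q2': "q2' \<in> succs K q2" "(q1', q2') \<in> bisim_upto K n"
      using bisim_upto_Suc_iff[OF K st] q1' by blast
    have "f q2' \<le> n"
      unfolding n_def using q2'(1) finite_succs[OF K st(2)] by auto
    then show False
      using bisim_upto_antimono[of "f q2'" n K] f q2' by blast
  qed
  ultimately show ?thesis
    unfolding bisim_equiv_def by (intro conjI ballI) (clarsimp simp del: INT_iff)+
qed

text \<open>\<open>GREATEST\<close> needs a witness: the intersection is itself a bisimulation and
  contains all others.\<close>

lemma bisim_eq_INT:
  assumes "kripke_structure K"
  shows "bisim K = (\<Inter>i. bisim_upto K i)"
  unfolding bisim_def
  using bisim_equiv_INT_bisim_upto[OF assms] bisim_equiv_subset_bisim_upto[OF assms]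
  by (intro Greatest_equality) auto

section \<open>Correctness, uniqueness and existence of \<open>D\<close>\<close>

lemma is_D_sat:
  assumes K: "kripke_structure K" and "is_D K q1 q2 \<phi>"
  shows "sat K q1 \<phi> \<and> \<not> sat K q2 \<phi>"
  using assms(2)
proof induction
  case (atom q1 q2)
  then show ?case
    using Min_in[of "label K q1 - label K q2"] finite_label[OF K] by auto
next
  case (neg_atom q1 q2)
  then show ?case
    using Min_in[of "label K q2 - label K q1"] finite_label[OF K] by auto
next
  case (ex_next q1 q2 c E \<psi>)
  \<comment> \<open>\<open>Min E\<close> is the witness for \<open>ExNext\<close> at
    \<open>q1\<close>: it satisfies every conjunct, while each successor \<open>q2'\<close> of
    \<open>q2\<close> falsifies its own conjunct \<open>\<psi> q2'\<close>.\<close>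
  have "Min E \<in> succs K q1"
    using Min_in[of E] finite_succs[OF K ex_next(1)] ex_next(6,7) by auto
  then show ?case
    using ex_next(8) by (auto simp: sat_big_conj finite_succs[OF K ex_next(2)])
next
  case (all_next q1 q2 c F \<psi>)
  \<comment> \<open>Dually, \<open>Min F\<close> satisfies the whole conjunction and so refutes
    \<open>AllNext\<close> at \<open>q2\<close>; each successor of \<open>q1\<close> falsifies its
    own conjunct.\<close>
  have "Min F \<in> succs K q2"
    using Min_in[of F] finite_succs[OF K all_next(2)] all_next(7,8) by auto
  then show ?case
    using all_next(9) by (auto simp: sat_big_conj finite_succs[OF K all_next(1)])
qed

text \<open>The guards of the four rules exclude one another, and they fix \<open>c\<close>,
  \<open>E\<close> and \<open>F\<close>; by induction the conjuncts are determined as well.\<close>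

lemma is_D_unique:
  assumes K: "kripke_structure K" and "is_D K q1 q2 \<phi>" "is_D K q1 q2 \<phi>'"
  shows "\<phi> = \<phi>'"
  using assms(2,3)
proof (induction arbitrary: \<phi>')
  case (atom q1 q2)
  from atom(6) show ?case by cases (use atom(4,5) in auto)
next
  case (neg_atom q1 q2)
  from neg_atom(7) show ?case by cases (use neg_atom(4,5) in auto)
next
  case outer: (ex_next q1 q2 c E \<psi>)
  from outer(9) show ?case
  proof cases
    case (ex_next c' E' \<psi>')
    have "E' = E" using ex_next(5,7) outer(4,6) by simp
    then have "\<psi> a = \<psi>' a" if "a \<in> succs K q2" for a
      using that outer(8) ex_next(9) by blast
    then show ?thesis
      unfolding ex_next(1) using big_conj_cong[OF finite_succs[OF K outer(2)]] by blast
  qed (use outer(4-7) in simp_all)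
next
  case outer: (all_next q1 q2 c F \<psi>)
  from outer(10) show ?case
  proof cases
    case (all_next c' F' \<psi>')
    have "F' = F" using all_next(5,8) outer(4,7) by simp
    then have "\<psi> a = \<psi>' a" if "a \<in> succs K q1" for a
      using that outer(9) all_next(10) by blast
    then show ?thesis
      unfolding all_next(1) using big_conj_cong[OF finite_succs[OF K outer(1)]] by blast
  qed (use outer(4-8) in auto)
qed

text \<open>Induction runs over any separating level \<open>n\<close>, not the least one: recursive
  pairs are known to be separated at level \<open>c - 1 < n\<close>, and their own characteristic
  numbers need not be computed.\<close>

lemma is_D_exists:
  assumes K: "kripke_structure K"
    and "q1 \<in> states K" "q2 \<in> states K" "(q1, q2) \<notin> bisim_upto K n"
  shows "\<exists>\<phi>. is_D K q1 q2 \<phi>"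
  using assms(2-)
proof (induction n arbitrary: q1 q2 rule: less_induct)
  case (less n)
  define c where "c = char_number K {q1} {q2}"
  have c_Least: "c = (LEAST c. (q1, q2) \<notin> bisim_upto K c)"
    unfolding c_def char_number_def by simp
  have cn: "c \<le> n"
    unfolding c_Least using less.prems(3) by (rule Least_le)
  have c: "(q1, q2) \<notin> bisim_upto K c"
    unfolding c_Least using less.prems(3) by (rule LeastI)
  have nb: "(q1, q2) \<notin> bisim K"
    using c bisim_eq_INT[OF K] by auto
  note pre = less.prems(1,2) nb
  have succ: "succs K q \<subseteq> states K" if "q \<in> states K" for q
    using K that by (simp add: kripke_structure_def)
  show ?case
  proof (cases c)
    case 0
    then have "label K q1 - label K q2 \<noteq> {} \<or> label K q2 - label K q1 \<noteq> {}"
      using c less.prems by auto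
    moreover have "char_number K {q1} {q2} = 0" using 0 c_def by simp
    ultimately show ?thesis
      by (metis is_D.atom[OF pre] is_D.neg_atom[OF pre])
  next
    case (Suc d)
    define E where
      "E = {q1' \<in> succs K q1. \<forall>q2'\<in>succs K q2. (q1', q2') \<notin> bisim_upto K (c - 1)}"
    define F where
      "F = {q2' \<in> succs K q2. \<forall>q1'\<in>succs K q1. (q1', q2') \<notin> bisim_upto K (c - 1)}"
    \<comment> \<open>By minimality of \<open>c\<close> the states are related at \<open>d\<close>
      but not at \<open>Suc d\<close>, so forth fails, giving \<open>E\<close>, or back fails,
      giving \<open>F\<close>.\<close>
    have "(q1, q2) \<in> bisim_upto K d"
      using not_less_Least[of d "\<lambda>c. (q1, q2) \<notin> bisim_upto K c"] Suc c_Least by auto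
    moreover have "(q1, q2) \<notin> bisim_upto K (Suc d)" using c Suc by simp
    ultimately have EF: "E \<noteq> {} \<or> F \<noteq> {}"
      unfolding E_def F_def Suc diff_Suc_1 bisim_upto_Suc_iff[OF K less.prems(1,2)] by blast
    have "d < n" "c \<noteq> 0" using cn Suc by auto
    show ?thesis
    proof (cases "E = {}")
      case False
      have "Min E \<in> E"
        using finite_succs[OF K less.prems(1)] by (intro Min_in False) (simp add: E_def)
      then have "Min E \<in> succs K q1"
        and "\<forall>q2'\<in>succs K q2. (Min E, q2') \<notin> bisim_upto K d"
        unfolding E_def Suc diff_Suc_1 by blast+
      then have "\<forall>q2'\<in>succs K q2. \<exists>\<phi>. is_D K (Min E) q2' \<phi>"
        using less.IH[OF \<open>d < n\<close>] succ less.prems(1,2) by blast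
      then obtain \<psi> where "\<forall>q2'\<in>succs K q2. is_D K (Min E) q2' (\<psi> q2')"
        by metis
      then show ?thesis
        using is_D.ex_next[OF pre c_def[symmetric] \<open>c \<noteq> 0\<close> E_def False] by blast
    next
      case True
      then have F: "F \<noteq> {}" using EF by simp
      have "Min F \<in> F"
        using finite_succs[OF K less.prems(2)] by (intro Min_in F) (simp add: F_def)
      then have "Min F \<in> succs K q2"
        and "\<forall>q1'\<in>succs K q1. (q1', Min F) \<notin> bisim_upto K d"
        unfolding F_def Suc diff_Suc_1 by blast+
      \<comment> \<open>\<open>F\<close> compares \<open>(q1', Min F)\<close>, but the recursion for
        \<open>D\<close> is on \<open>(Min F, q1')\<close>.\<close>
      moreover have "sym (bisim_upto K d)"
        using equiv_bisim_upto by (rule equivE)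
      ultimately have "\<forall>q1'\<in>succs K q1. \<exists>\<phi>. is_D K (Min F) q1' \<phi>"
        using less.IH[OF \<open>d < n\<close>] succ less.prems(1,2) by (meson subsetD symD)
      then obtain \<psi> where "\<forall>q1'\<in>succs K q1. is_D K (Min F) q1' (\<psi> q1')"
        by metis
      then show ?thesis
        using is_D.all_next[OF pre c_def[symmetric] \<open>c \<noteq> 0\<close> True[unfolded E_def] F_def F]
        by blast
    qed
  qed
qed

text \<open>Since \<open>bisim\<close> is the intersection of all levels, non-bisimilar states are
  separated at some finite level, where the existence induction can start.\<close>

lemma is_D_ex1:
  assumes K: "kripke_structure K"
    and "q1 \<in> states K" "q2 \<in> states K" "(q1, q2) \<notin> bisim K"
  shows "\<exists>!\<phi>. is_D K q1 q2 \<phi>"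
  using is_D_exists[OF K assms(2,3)] is_D_unique[OF K] assms(4) bisim_eq_INT[OF K] by blast

section \<open>Consistency of the separating formula\<close>

theorem theorem5:
  fixes K :: "('q::linorder, 'ap::linorder) kripke"
    and Sp Sm :: "'q set"
  assumes "kripke_structure K"
    and "sample K Sp Sm"
  shows "(\<forall>p\<in>Sp. \<forall>m\<in>Sm. \<exists>!\<phi>. is_D K p m \<phi>) \<and>
         consistent K (separating_formula K Sp Sm) Sp Sm"
proof -
  have ex1: "\<exists>!\<phi>. is_D K p m \<phi>" if "p \<in> Sp" "m \<in> Sm" for p m
    using is_D_ex1[OF assms(1)] assms(2) that unfolding sample_def by blast
  have D: "sat K p (D K p m) \<and> \<not> sat K m (D K p m)" if "p \<in> Sp" "m \<in> Sm" for p m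
    using is_D_sat[OF assms(1)] theI'[OF ex1[OF that]] unfolding D_def by blast
  \<comment> \<open>Finiteness matters because \<open>sorted_list_of_set\<close> is empty on
    infinite sets.\<close>
  have "finite Sp" "finite Sm"
    using assms unfolding kripke_structure_def sample_def by (auto intro: finite_subset)
  \<comment> \<open>Each \<open>p\<close> in \<open>Sp\<close> satisfies its own disjunct; each
    \<open>m\<close> in \<open>Sm\<close> falsifies the conjunct for \<open>m\<close> in every
    disjunct.\<close>
  then have "consistent K (separating_formula K Sp Sm) Sp Sm"
    using D unfolding consistent_def separating_formula_def
    by (auto simp: sat_big_disj sat_big_conj)
  then show ?thesis using ex1 by blast
qed

end
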